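(* Let $f:\mathbb{R}^2\to\mathbb{R}$ and $g_i:\mathbb{R}^2\to\mathbb{R}$, $i=1,\dots,m$, be convex functions, let $S:=\{x\in\mathbb{R}^2: g_i(x)\le 0 \text{ for } 1\le i\le m\}$, let $B\in\mathbb{N}$ and $k\ge 2$. Let $\hat x_1^*,\dots,\hat x_{k-1}^*$ be the $k-1$ best points for $$\min\{f(\hat x):\hat x\in S\cap[-B,B]^2\cap\mathbb{Z}^2\}.$$ Then, in a number of evaluations of $f$ and $g_1,\dots,g_m$ that is polynomial in $\ln(B)$ and in $k$, one can either (a) find a $k$-th best point $\hat x_k^*$, or (b) show that there is no such point.
   Context: Best points: $\hat x_1^*$ is a minimizer of $f$ over $S\cap[-B,B]^2\cap\mathbb{Z}^2$, and for $j\ge 2$ a $j$-th best point is $$\hat x_j^*\in\arg\min\{f(\hat x):\hat x\in(S\cap[-B,B]^2\cap\mathbb{Z}^2)\setminus\{\hat x_1^*,\dots,\hat x_{j-1}^*\}\}.$$ The functions are accessed through evaluations: an evaluation of a function at a point returns its value at that point. The statement asserts the existence of an algorithm which, given $B$, $k$, $\hat x_1^*,\dots,\hat x_{k-1}^*$ and access to $f,g_1,\dots,g_m$ by evaluations, correctly ends in outcome (a) or (b) within the stated number of evaluations. *)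

theory Defs
  imports "HOL-Analysis.Analysis" "HOL-Computational_Algebra.Polynomial"
begin

type_synonym point = "real ^ 2"

definition feasible_region :: "nat \<Rightarrow> (nat \<Rightarrow> point \<Rightarrow> real) \<Rightarrow> point set" where
  "feasible_region m g = {x. \<forall>i\<in>{1..m}. g i x \<le> 0}"

definition integer_box :: "nat \<Rightarrow> point set" where
  "integer_box B = {x. \<forall>i. x $ i \<in> \<int> \<and> - real B \<le> x $ i \<and> x $ i \<le> real B}"

definition next_best :: "(point \<Rightarrow> real) \<Rightarrow> point set \<Rightarrow> point list \<Rightarrow> point \<Rightarrow> bool" where
  "next_best f D ys x \<longleftrightarrow> is_arg_min f (\<lambda>y. y \<in> D - set ys) x"

definition best_points :: "(point \<Rightarrow> real) \<Rightarrow> point set \<Rightarrow> point list \<Rightarrow> bool" where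
  "best_points f D xs \<longleftrightarrow> (\<forall>j<length xs. next_best f D (take j xs) (xs ! j))"

text \<open>
  An algorithm with evaluation access is a well-founded adaptive tree: each inner node evaluates
  one function at one point and branches on the real number returned. The next query and
  the output may depend on the functions only through values returned earlier. Only
  evaluations are counted; other computations are free.
\<close>

datatype fun_id = Objective | Constraint nat

datatype 'r eval_alg = Return 'r | Eval fun_id point "real \<Rightarrow> 'r eval_alg"

primrec interp :: "(point \<Rightarrow> real) \<Rightarrow> (nat \<Rightarrow> point \<Rightarrow> real) \<Rightarrow> fun_id \<Rightarrow> point \<Rightarrow> real" where
  "interp f g Objective = f"
| "interp f g (Constraint i) = g i"

primrec outcome :: "(fun_id \<Rightarrow> point \<Rightarrow> real) \<Rightarrow> 'r eval_alg \<Rightarrow> 'r" where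
  "outcome F (Return r) = r"
| "outcome F (Eval s x c) = outcome F (c (F s x))"

primrec evaluations :: "(fun_id \<Rightarrow> point \<Rightarrow> real) \<Rightarrow> 'r eval_alg \<Rightarrow> (fun_id \<times> point) list" where
  "evaluations F (Return r) = []"
| "evaluations F (Eval s x c) = (s, x) # evaluations F (c (F s x))"

text \<open>
  Evaluations are counted separately for each function, so that a bound need not grow with the
  number \<open>m\<close> of constraints; a bound \<open>b\<close> on every count bounds their total by \<open>(m + 1) * b\<close>.
\<close>

definition num_evaluations :: "(fun_id \<Rightarrow> point \<Rightarrow> real) \<Rightarrow> 'r eval_alg \<Rightarrow> fun_id \<Rightarrow> nat" where
  "num_evaluations F A s = count_list (map fst (evaluations F A)) s"

text \<open>Bivariate real polynomials are polynomials in the second variable over those in the first.\<close>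

definition poly2 :: "real poly poly \<Rightarrow> real \<Rightarrow> real \<Rightarrow> real" where
  "poly2 p x y = poly (poly p [:y:]) x"

end

theory Submission
  imports Defs
begin

text \<open>
  The algorithm is a cutting-plane method on finite sets of lattice points. Call a finite set
  \<open>P\<close> of lattice points lattice-convex if it contains every lattice point of its convex hull. Such
  a set has a deep point: a point \<open>c\<close> of \<open>P\<close> such that every open half-plane avoiding \<open>c\<close> contains
  at most three quarters of \<open>P\<close> (\<open>deep_point_exists\<close>). This is the centerpoint theorem with the Helly
  number \<open>4\<close> of the planar integer lattice, and it rests on Doignon's parity argument: among five
  lattice points two have a lattice point as midpoint.

  At a deep point \<open>c\<close> the constraints are evaluated. If some \<open>g i c\<close> is positive, all feasible points
  lie in the sublevel set \<open>{z. g i z < g i c}\<close>; otherwise \<open>c\<close> is feasible, is compared with the best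
  point recorded so far, and only points with \<open>f z < f c\<close> remain of interest. Either way there is
  one convex function \<open>F\<close> for which \<open>P\<close> may be replaced by any subset that contains all its
  points with \<open>F z < F c\<close>. No subgradients are available, but only finitely many
  directions from \<open>c\<close> lead to other points of \<open>P\<close>. Each of these directions is represented by a
  point on one of the three vertical lines through \<open>c\<close> and at distance \<open>1\<close> from it; on a line the
  function is convex, so a binary search finds exactly the representatives
  with value below \<open>F c\<close>. These lie in a convex set that does not contain \<open>c\<close>,
  so an open half-plane avoiding \<open>c\<close> contains them, and with them all points of interest
  (\<open>outcome_cut_at\<close>). Intersecting \<open>P\<close> with this half-plane keeps it lattice-convex and removes
  at least a quarter of its points.

  Starting from a subset of the box, which has \<open>(2 * B + 1)\<^sup>2\<close> points, this takes \<open>O(ln B)\<close> rounds of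
  \<open>O(ln B)\<close> evaluations. Removing the best points already known would destroy convexity, but they cut the plane
  into at most \<open>k\<close> gaps with respect to the lexicographic order of coordinates, the gaps are convex,
  and the method is run on each of them.
\<close>

section \<open>Deep lattice points\<close>

definition lattice :: "point set" where
  "lattice = {x. \<forall>i. x $ i \<in> \<int>}"

definition lattice_convex :: "point set \<Rightarrow> bool" where
  "lattice_convex P \<longleftrightarrow> finite P \<and> P \<subseteq> lattice \<and> convex hull P \<inter> lattice \<subseteq> P"

text \<open>
  Lattice-convexity survives every cut, so the cutting-plane method never leaves the class of
  sets that have deep points.
\<close>

lemma lattice_convex_Int_convex:
  assumes "lattice_convex P" "convex K"
  shows "lattice_convex (P \<inter> K)"
proof -
  have "convex hull (P \<inter> K) \<subseteq> K"
    using assms(2) by (simp add: hull_minimal)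
  moreover have "convex hull (P \<inter> K) \<subseteq> convex hull P"
    by (simp add: hull_mono)
  ultimately show ?thesis
    using assms(1) unfolding lattice_convex_def by blast
qed

lemma lattice_midpoint_if_same_parity:
  assumes "p \<in> lattice" "q \<in> lattice" "\<And>i. even \<lfloor>p $ i\<rfloor> \<longleftrightarrow> even \<lfloor>q $ i\<rfloor>"
  shows "midpoint p q \<in> lattice"
proof -
  have "midpoint p q $ i \<in> \<int>" for i
  proof -
    have "p $ i = of_int \<lfloor>p $ i\<rfloor>" "q $ i = of_int \<lfloor>q $ i\<rfloor>"
      using assms(1,2) by (auto simp: lattice_def)
    moreover have "even (\<lfloor>p $ i\<rfloor> + \<lfloor>q $ i\<rfloor>)"
      using assms(3)[of i] by simp
    then obtain n where "\<lfloor>p $ i\<rfloor> + \<lfloor>q $ i\<rfloor> = 2 * n"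
      by (elim evenE)
    then have "real_of_int \<lfloor>p $ i\<rfloor> + real_of_int \<lfloor>q $ i\<rfloor> = 2 * real_of_int n"
      by (metis of_int_add of_int_mult of_int_numeral)
    ultimately have "midpoint p q $ i = of_int n"
      by (simp add: midpoint_def)
    then show ?thesis by simp
  qed
  then show ?thesis by (simp add: lattice_def)
qed

lemma lattice_midpoint_among_five:
  assumes "S \<subseteq> lattice" "finite S" "5 \<le> card S"
  obtains p q where "p \<in> S" "q \<in> S" "p \<noteq> q" "midpoint p q \<in> lattice"
proof -
  let ?par = "\<lambda>x :: point. (even \<lfloor>x $ 1\<rfloor>, even \<lfloor>x $ 2\<rfloor>)"
  have "card (?par ` S) \<le> card (UNIV :: (bool \<times> bool) set)"
    by (intro card_mono) auto
  also have "\<dots> = 4" by (simp add: UNIV_Times_UNIV[symmetric] del: UNIV_Times_UNIV)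
  finally have "\<not> inj_on ?par S"
    using assms(3) card_image[of ?par S] by linarith
  then obtain p q where pq: "p \<in> S" "q \<in> S" "p \<noteq> q" "?par p = ?par q"
    by (auto simp: inj_on_def)
  have "even \<lfloor>p $ i\<rfloor> \<longleftrightarrow> even \<lfloor>q $ i\<rfloor>" for i
    using pq(4) exhaust_2[of i] by auto
  then show thesis
    using that pq lattice_midpoint_if_same_parity assms(1) by blast
qed

text \<open>
  This is the combinatorial core of Doignon's theorem. If no point of \<open>S\<close> lies in the hull of the
  others, two of them, \<open>p\<close> and \<open>q\<close>, have a lattice midpoint \<open>m\<close>. Replacing a point of \<open>S\<close> by another
  lattice point of the hull makes the hull strictly smaller, so the claim may be assumed for the
  new set. Replacing \<open>p\<close> by \<open>m\<close> gives a point \<open>w\<close> that lies in all hulls of \<open>S\<close> with one point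
  deleted, except possibly the one without \<open>q\<close>. Replacing \<open>q\<close> by \<open>w\<close> repairs this last hull.
\<close>

lemma common_lattice_point_of_deleted_hulls:
  assumes "lattice_convex P" "S \<subseteq> P" "5 \<le> card S"
  shows "\<exists>w\<in>P. \<forall>s\<in>S. w \<in> convex hull (S - {s})"
  using assms(2,3)
proof (induction "card (convex hull S \<inter> P)" arbitrary: S rule: less_induct)
  case less
  have finP: "finite P" and PL: "P \<subseteq> lattice" and hullP: "convex hull P \<inter> lattice \<subseteq> P"
    using assms(1) by (auto simp: lattice_convex_def)
  have finS: "finite S"
    using finP less.prems(1) finite_subset by blast
  show ?case
  proof (cases "\<exists>s\<in>S. s \<in> convex hull (S - {s})")
    case True
    then obtain s where s: "s \<in> S" "s \<in> convex hull (S - {s})" by blast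
    have "s \<in> convex hull (S - {t})" if "t \<in> S" for t
      using s that by (cases "t = s") (auto intro: hull_inc)
    then show ?thesis using s(1) less.prems(1) by blast
  next
    case False
    then have indep: "\<And>s. s \<in> S \<Longrightarrow> s \<notin> convex hull (S - {s})" by blast
    (* The points of S are extreme in its hull: what remains of the hull without one of them is
       convex and cannot generate it again. *)
    have still: "convex (convex hull S - {s})" if "s \<in> S" for s
      using extreme_point_of_convex_hull_convex_independent[of S s] indep that finS
      by (simp add: extreme_point_of_stillconvex finite_imp_compact)
    have avoid: "s \<notin> convex hull X" if "s \<in> S" "X \<subseteq> convex hull S" "s \<notin> X" for s X
      using hull_minimal[of X "convex hull S - {s}" convex] still[OF that(1)] that by blast
    have exchange: "\<exists>w\<in>P. \<forall>t \<in> insert x (S - {s}). w \<in> convex hull (insert x (S - {s}) - {t})"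
      if "s \<in> S" "x \<in> P" "x \<in> convex hull S" "x \<notin> S" for s x
    proof (rule less.hyps)
      let ?S' = "insert x (S - {s})"
      have sub: "?S' \<subseteq> convex hull S"
        using that(3) by (auto intro: hull_inc)
      have "s \<notin> convex hull ?S'"
        using avoid[OF that(1) sub] that by auto
      moreover have "convex hull ?S' \<subseteq> convex hull S"
        using sub by (simp add: hull_minimal)
      moreover have "s \<in> convex hull S \<inter> P"
        using that(1) less.prems(1) by (auto intro: hull_inc)
      ultimately have "convex hull ?S' \<inter> P \<subset> convex hull S \<inter> P" by blast
      then show "card (convex hull ?S' \<inter> P) < card (convex hull S \<inter> P)"
        using finP by (intro psubset_card_mono) auto
      show "?S' \<subseteq> P" using that less.prems(1) by auto
      show "5 \<le> card ?S'"
        using less.prems(2) that(1,4) finS by (simp add: card_Suc_Diff1 del: card_Diff_insert)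
    qed
    obtain p q where pq: "p \<in> S" "q \<in> S" "p \<noteq> q" "midpoint p q \<in> lattice"
      using lattice_midpoint_among_five[of S] less.prems PL finS by blast
    define m where "m = midpoint p q"
    have m_hull: "m \<in> convex hull X" if "p \<in> X" "q \<in> X" for X
      unfolding m_def using that
      by (meson convex_contains_segment convex_convex_hull hull_inc midpoint_in_closed_segment subsetD)
    have mP: "m \<in> P"
      using m_hull[of P] pq hullP less.prems(1) by (auto simp: m_def)
    have "m \<noteq> p" "m \<noteq> q" using pq(3) by (auto simp: m_def)
    have mS: "m \<notin> S"
    proof
      assume "m \<in> S"
      then show False
        using indep[of m] m_hull[of "S - {m}"] pq \<open>m \<noteq> p\<close> \<open>m \<noteq> q\<close> by auto
    qed
    obtain w where w: "w \<in> P"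
        "\<And>t. t \<in> insert m (S - {p}) \<Longrightarrow> w \<in> convex hull (insert m (S - {p}) - {t})"
      using exchange[OF pq(1) mP _ mS] m_hull[of S] pq by blast
    have w_hull: "w \<in> convex hull (S - {s})" if "s \<in> S" "s \<noteq> q" for s
    proof (cases "s = p")
      case True
      have "insert m (S - {p}) - {m} = S - {p}" using mS by auto
      then show ?thesis using w(2)[of m] True by simp
    next
      case False
      have "insert m (S - {p}) - {s} \<subseteq> convex hull (S - {s})"
        using m_hull[of "S - {s}"] pq that False by (auto intro: hull_inc)
      then have "convex hull (insert m (S - {p}) - {s}) \<subseteq> convex hull (S - {s})"
        by (simp add: hull_minimal)
      then show ?thesis using w(2)[of s] that False by auto
    qed
    have "w \<noteq> q"
    proof -
      have "q \<notin> convex hull (insert m (S - {p}) - {q})"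
        using m_hull[of S] pq by (intro avoid) (auto intro: hull_inc)
      then show ?thesis using w(2)[of q] pq by auto
    qed
    have wS: "w \<notin> S" using w_hull indep \<open>w \<noteq> q\<close> by metis
    have "w \<in> convex hull S"
      using w_hull[OF pq(1) pq(3)] hull_mono[of "S - {p}" S] by blast
    then obtain v where v: "v \<in> P"
        "\<And>t. t \<in> insert w (S - {q}) \<Longrightarrow> v \<in> convex hull (insert w (S - {q}) - {t})"
      using exchange[OF pq(2) w(1) _ wS] by blast
    have "v \<in> convex hull (S - {s})" if "s \<in> S" for s
    proof (cases "s = q")
      case True
      have "insert w (S - {q}) - {w} = S - {q}" using wS by auto
      then show ?thesis using v(2)[of w] True by simp
    next
      case False
      have "insert w (S - {q}) - {s} \<subseteq> convex hull (S - {s})"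
        using w_hull[OF that False] by (auto intro: hull_inc)
      then have "convex hull (insert w (S - {q}) - {s}) \<subseteq> convex hull (S - {s})"
        by (simp add: hull_minimal)
      then show ?thesis using v(2)[of s] that False by auto
    qed
    then show ?thesis using v(1) by blast
  qed
qed

definition deep :: "point set \<Rightarrow> point \<Rightarrow> bool" where
  "deep P c \<longleftrightarrow> c \<in> P \<and> (\<forall>a. 4 * card {z \<in> P. a \<bullet> z < a \<bullet> c} \<le> 3 * card P)"

lemma finite_minimal_subset:
  assumes "finite F" "Q F"
  obtains G where "G \<subseteq> F" "Q G" "\<And>H. H \<subset> G \<Longrightarrow> \<not> Q H"
proof -
  have "\<exists>G\<subseteq>F. Q G \<and> (\<forall>H. H \<subset> G \<longrightarrow> \<not> Q H)"
    using assms
  proof (induction F rule: finite_psubset_induct)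
    case (psubset A)
    then show ?case by (metis order_refl psubset_imp_subset subset_trans)
  qed
  then show thesis using that by blast
qed

text \<open>
  A point common to all half-planes that contain more than three quarters of \<open>P\<close> is deep: an open
  half-plane avoiding the point cannot be one of them. If there were no such point in \<open>P\<close>, a minimal subfamily
  with empty intersection would have at least five members, as the complements of four cannot
  cover \<open>P\<close>. By minimality each member \<open>A\<close> is missed by some point \<open>p A\<close> of all the others, and the
  common point of the hulls obtained by deleting one \<open>p A\<close> lies in every member.
\<close>

lemma deep_point_exists:
  assumes "lattice_convex P" "P \<noteq> {}"
  shows "\<exists>c. deep P c"
proof -
  have finP: "finite P"
    using assms(1) by (auto simp: lattice_convex_def)
  define F where
    "F = {A. \<exists>a b. A = {z \<in> P. a \<bullet> z < b} \<and> 3 * card P < 4 * card A}"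
  have "F \<subseteq> Pow P" by (auto simp: F_def)
  then have finF: "finite F" using finP finite_subset by blast
  have "P \<inter> \<Inter>F \<noteq> {}"
  proof
    assume "P \<inter> \<Inter>F = {}"
    then obtain G where G: "G \<subseteq> F" "P \<inter> \<Inter>G = {}" "\<And>H. H \<subset> G \<Longrightarrow> P \<inter> \<Inter>H \<noteq> {}"
      using finite_minimal_subset[OF finF, of "\<lambda>G. P \<inter> \<Inter>G = {}"] by metis
    have finG: "finite G" using G(1) finF finite_subset by blast
    have "5 \<le> card G"
    proof (rule ccontr)
      assume "\<not> 5 \<le> card G"
      then have cardG: "card G \<le> 4" by simp
      have posP: "0 < card P" using assms(2) finP by (simp add: card_gt_0_iff)
      have each: "4 * card (P - A) \<le> card P - 1" if "A \<in> G" for A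
      proof -
        have A: "A \<subseteq> P" "3 * card P < 4 * card A"
          using that G(1) by (auto simp: F_def)
        then have "card (P - A) = card P - card A"
          using finP by (meson card_Diff_subset finite_subset)
        then show ?thesis using A(2) by linarith
      qed
      have "P = (\<Union>A\<in>G. P - A)" using G(2) by auto
      then have "card P \<le> (\<Sum>A\<in>G. card (P - A))"
        using card_UN_le[OF finG, of "\<lambda>A. P - A"] by simp
      then have "4 * card P \<le> (\<Sum>A\<in>G. 4 * card (P - A))"
        by (simp add: sum_distrib_left[symmetric])
      also have "\<dots> \<le> card G * (card P - 1)"
        using sum_mono[of G "\<lambda>A. 4 * card (P - A)" "\<lambda>_. card P - 1"] each by simp
      also have "\<dots> \<le> 4 * (card P - 1)" using cardG by simp
      finally show False using posP by simp
    qed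
    have "\<exists>x. x \<in> P \<inter> \<Inter>(G - {A})" if "A \<in> G" for A
      using G(3)[of "G - {A}"] that by blast
    then obtain p where p: "\<And>A. A \<in> G \<Longrightarrow> p A \<in> P \<inter> \<Inter>(G - {A})" by metis
    have pA: "p A \<notin> A" if "A \<in> G" for A
      using p[OF that] G(2) that by blast
    have inj: "inj_on p G"
      by (rule inj_onI) (metis DiffI IntD2 InterE pA p singletonD)
    have "5 \<le> card (p ` G)" using \<open>5 \<le> card G\<close> card_image[OF inj] by simp
    moreover have "p ` G \<subseteq> P" using p by auto
    ultimately have "\<exists>w\<in>P. \<forall>s\<in>p ` G. w \<in> convex hull (p ` G - {s})"
      by (intro common_lattice_point_of_deleted_hulls[OF assms(1)])
    then obtain w where w: "w \<in> P" "\<And>s. s \<in> p ` G \<Longrightarrow> w \<in> convex hull (p ` G - {s})"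
      by blast
    have "w \<in> A" if AG: "A \<in> G" for A
    proof -
      obtain a b where A: "A = {z \<in> P. a \<bullet> z < b}"
        using AG G(1) by (auto simp: F_def)
      have "p C \<in> A" if "C \<in> G" "C \<noteq> A" for C
        using p[OF that(1)] AG that(2) by blast
      then have "p ` G - {p A} \<subseteq> {z. a \<bullet> z < b}"
        unfolding A by blast
      then have "convex hull (p ` G - {p A}) \<subseteq> {z. a \<bullet> z < b}"
        by (intro hull_minimal) (auto simp: convex_halfspace_lt)
      moreover have "w \<in> convex hull (p ` G - {p A})" using w(2) AG by simp
      ultimately show ?thesis using w(1) unfolding A by blast
    qed
    then show False using w(1) G(2) by blast
  qed
  then obtain c where "c \<in> P \<inter> \<Inter>F" by (meson ex_in_conv)
  then have c: "c \<in> P" "\<And>A. A \<in> F \<Longrightarrow> c \<in> A" by auto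
  have "4 * card {z \<in> P. a \<bullet> z < a \<bullet> c} \<le> 3 * card P" for a
  proof (rule ccontr)
    assume "\<not> ?thesis"
    then have "{z \<in> P. a \<bullet> z < a \<bullet> c} \<in> F"
      unfolding F_def by (intro CollectI exI[of _ a] exI[of _ "a \<bullet> c"]) simp
    from c(2)[OF this] show False by simp
  qed
  then show ?thesis using c(1) by (auto simp: deep_def)
qed

section \<open>Composition of evaluation algorithms\<close>

primrec bind_alg :: "'a eval_alg \<Rightarrow> ('a \<Rightarrow> 'b eval_alg) \<Rightarrow> 'b eval_alg" where
  "bind_alg (Return r) h = h r"
| "bind_alg (Eval s x c) h = Eval s x (\<lambda>v. bind_alg (c v) h)"

lemma outcome_bind_alg [simp]:
  "outcome F (bind_alg A h) = outcome F (h (outcome F A))"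
  by (induction A) auto

lemma num_evaluations_Return [simp]: "num_evaluations F (Return r) s = 0"
  by (simp add: num_evaluations_def)

lemma num_evaluations_Eval [simp]:
  "num_evaluations F (Eval s x c) s' =
     (if s = s' then 1 else 0) + num_evaluations F (c (F s x)) s'"
  by (simp add: num_evaluations_def)

lemma num_evaluations_bind_alg [simp]:
  "num_evaluations F (bind_alg A h) s =
     num_evaluations F A s + num_evaluations F (h (outcome F A)) s"
  by (induction A) auto

section \<open>Searching a line for the points below a level\<close>

text \<open>
  Both searches take a sorted list of parameters on the line \<open>\<psi>\<close> and report the parameters
  whose value is below \<open>t\<close>. The first one expects those to form a prefix. In the second one they form an
  interval at an unknown place: as long as the middle value is too large, comparing it with the
  next value tells which half contains no small value, and once a small value is hit the interval
  extends from it to both sides as a prefix. The bound \<open>l\<close> on the binary length of the list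
  makes the recursion structural.
\<close>

primrec prefix_below ::
  "fun_id \<Rightarrow> (real \<Rightarrow> point) \<Rightarrow> real \<Rightarrow> nat \<Rightarrow> real list \<Rightarrow> real set eval_alg" where
  "prefix_below s \<psi> t 0 ys = Return {}"
| "prefix_below s \<psi> t (Suc l) ys =
     (let xs = take (length ys div 2) ys in
      case drop (length ys div 2) ys of
        [] \<Rightarrow> Return {}
      | y # zs \<Rightarrow> Eval s (\<psi> y) (\<lambda>v.
          if v < t
          then bind_alg (prefix_below s \<psi> t l zs) (\<lambda>A. Return (set xs \<union> {y} \<union> A))
          else prefix_below s \<psi> t l xs))"

primrec valley_below ::
  "fun_id \<Rightarrow> (real \<Rightarrow> point) \<Rightarrow> real \<Rightarrow> nat \<Rightarrow> real list \<Rightarrow> real set eval_alg" where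
  "valley_below s \<psi> t 0 ys = Return {}"
| "valley_below s \<psi> t (Suc l) ys =
     (let xs = take (length ys div 2) ys in
      case drop (length ys div 2) ys of
        [] \<Rightarrow> Return {}
      | y # zs \<Rightarrow> Eval s (\<psi> y) (\<lambda>v.
          if v < t
          then bind_alg (prefix_below s \<psi> t l (rev xs)) (\<lambda>A.
               bind_alg (prefix_below s \<psi> t l zs) (\<lambda>B. Return (A \<union> {y} \<union> B)))
          else (case zs of
              [] \<Rightarrow> valley_below s \<psi> t l xs
            | z # _ \<Rightarrow> Eval s (\<psi> z) (\<lambda>w.
                if v \<le> w then valley_below s \<psi> t l xs else valley_below s \<psi> t l zs))))"

lemma split_at_half:
  obtains "drop (length ys div 2) ys = []" "ys = []"
  | xs y zs where "take (length ys div 2) ys = xs" "drop (length ys div 2) ys = y # zs"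
      "ys = xs @ y # zs" "length ys < 2 ^ Suc l \<Longrightarrow> length xs < 2 ^ l \<and> length zs < 2 ^ l"
proof (cases "drop (length ys div 2) ys")
  case Nil
  then have "ys = []"
    by (metis Suc_1 drop_eq_Nil div_less_dividend length_greater_0_conv lessI not_le)
  then show thesis using that(1) Nil by blast
next
  case (Cons y zs)
  have "length (y # zs) = length ys - length ys div 2"
    unfolding Cons[symmetric] by simp
  then have "length zs + 1 = length ys - length ys div 2" by simp
  then have "length ys < 2 ^ Suc l \<Longrightarrow> length (take (length ys div 2) ys) < 2 ^ l \<and> length zs < 2 ^ l"
    by auto
  moreover have "ys = take (length ys div 2) ys @ y # zs"
    using append_take_drop_id[of "length ys div 2" ys] Cons by simp
  ultimately show thesis using that(2) Cons by blast
qed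

lemma outcome_prefix_below:
  assumes "length ys < 2 ^ l"
    "sorted_wrt (\<lambda>x y. F s (\<psi> y) < t \<longrightarrow> F s (\<psi> x) < t) ys"
  shows "outcome F (prefix_below s \<psi> t l ys) = {y \<in> set ys. F s (\<psi> y) < t}"
  using assms
proof (induction l arbitrary: ys)
  case (Suc l)
  show ?case
  proof (cases rule: split_at_half[where ys = ys and l = l])
    case 1
    then show ?thesis by simp
  next
    case (2 xs y zs)
    have "length xs < 2 ^ l" "length zs < 2 ^ l" using 2(4) Suc.prems(1) by auto
    note IH = Suc.IH[OF \<open>length xs < 2 ^ l\<close>] Suc.IH[OF \<open>length zs < 2 ^ l\<close>]
    have sorted: "sorted_wrt (\<lambda>x y. F s (\<psi> y) < t \<longrightarrow> F s (\<psi> x) < t) (xs @ y # zs)"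
      using Suc.prems(2) 2(3) by simp
    then show ?thesis
      using IH unfolding prefix_below.simps Let_def 2(1,2)
      by (auto simp: sorted_wrt_append 2(3))
  qed
qed simp

lemma num_evaluations_prefix_below:
  "num_evaluations F (prefix_below s \<psi> t l ys) s' \<le> (if s' = s then l else 0)"
proof (induction l arbitrary: ys)
  case (Suc l)
  show ?case
    using Suc by (auto simp: Let_def split: list.split if_splits)
qed simp

text \<open>
  Every discarding step of the valley search is an instance of this or of its contrapositive.
\<close>

lemma convex_on_mono_after_rise:
  fixes h :: "real \<Rightarrow> real"
  assumes "convex_on UNIV h" "x < y" "y \<le> z" "h x \<le> h y"
  shows "h y \<le> h z"
proof (rule ccontr)
  assume "\<not> ?thesis"
  then have fall: "h z < h y" and "y < z" using assms(3) by (auto simp: less_le)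
  have "(h x - h y) / (x - y) \<le> (h y - h z) / (y - z)"
    using convex_on_slope_le[OF assms(1), of x z y] assms(2) \<open>y < z\<close> by simp
  moreover have "0 \<le> (h x - h y) / (x - y)"
    using assms(2,4) by (simp add: divide_nonpos_neg)
  moreover have "(h y - h z) / (y - z) < 0"
    using fall \<open>y < z\<close> by (simp add: divide_pos_neg)
  ultimately show False by linarith
qed

lemma outcome_valley_below:
  assumes "length ys < 2 ^ l" "sorted_wrt (<) ys" and convex: "convex_on UNIV (\<lambda>y. F s (\<psi> y))"
  shows "outcome F (valley_below s \<psi> t l ys) = {y \<in> set ys. F s (\<psi> y) < t}"
  using assms(1,2)
proof (induction l arbitrary: ys)
  case (Suc l)
  let ?h = "\<lambda>y. F s (\<psi> y)"
  note rise = convex_on_mono_after_rise[OF convex]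
  show ?case
  proof (cases rule: split_at_half[where ys = ys and l = l])
    case 1
    then show ?thesis by simp
  next
    case (2 xs y zs)
    have len: "length xs < 2 ^ l" "length zs < 2 ^ l" using 2(4) Suc.prems(1) by auto
    have sorted: "sorted_wrt (<) xs" "sorted_wrt (<) zs"
        and below: "\<And>x. x \<in> set xs \<Longrightarrow> x < y" and above: "\<And>z. z \<in> set zs \<Longrightarrow> y < z"
      using Suc.prems(2) by (auto simp: 2(3) sorted_wrt_append)
    note IH = Suc.IH[OF len(1) sorted(1)] Suc.IH[OF len(2) sorted(2)]
    show ?thesis
    proof (cases "?h y < t")
      case True
      have "?h b < t" if "a < b" "b < y" "?h a < t" for a b
        using rise[of a b y] that True by fastforce
      then have "sorted_wrt (\<lambda>x y. ?h y < t \<longrightarrow> ?h x < t) (rev xs)"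
        unfolding sorted_wrt_rev
        using below by (intro sorted_wrt_mono_rel[OF _ sorted(1)]) auto
      moreover have "?h a < t" if "y < a" "a < b" "?h b < t" for a b
        using rise[of y a b] that True by fastforce
      then have "sorted_wrt (\<lambda>x y. ?h y < t \<longrightarrow> ?h x < t) zs"
        using above by (intro sorted_wrt_mono_rel[OF _ sorted(2)]) auto
      ultimately have "outcome F (prefix_below s \<psi> t l (rev xs)) = {y \<in> set xs. ?h y < t}"
          "outcome F (prefix_below s \<psi> t l zs) = {y \<in> set zs. ?h y < t}"
        using outcome_prefix_below[of "rev xs" l F s \<psi> t] outcome_prefix_below[of zs l F s \<psi> t] len
        by auto
      then show ?thesis
        unfolding valley_below.simps Let_def 2(1,2) using True by (auto simp: 2(3))
    next
      case False
      show ?thesis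
      proof (cases zs)
        case Nil
        then show ?thesis
          unfolding valley_below.simps Let_def 2(1,2) using False IH by (auto simp: 2(3))
      next
        case (Cons z us)
        show ?thesis
        proof (cases "?h y \<le> ?h z")
          case True
          have "\<not> ?h u < t" if "u \<in> set zs" for u
            using that rise[of y z u] True False above[of z] sorted(2) Cons by fastforce
          then show ?thesis
            unfolding valley_below.simps Let_def 2(1,2) using False True IH
            by (auto simp: 2(3) Cons)
        next
          case fall: False
          have "\<not> ?h u < t" if "u \<in> set xs" for u
            using that rise[of u y z] fall False above[of z] below[of u] Cons by fastforce
          then show ?thesis
            unfolding valley_below.simps Let_def 2(1,2) using False fall IH
            by (auto simp: 2(3) Cons)
        qed
      qed
    qed
  qed
qed simp

lemma num_evaluations_valley_below:
  "num_evaluations F (valley_below s \<psi> t l ys) s' \<le> (if s' = s then 2 * l else 0)"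
proof (induction l arbitrary: ys)
  case (Suc l)
  show ?case
  proof (cases rule: split_at_half[where ys = ys and l = l])
    case (2 xs y zs)
    note bounds = Suc.IH[of xs] Suc.IH[of zs]
        num_evaluations_prefix_below[of F s \<psi> t l "rev xs" s']
        num_evaluations_prefix_below[of F s \<psi> t l zs s']
    show ?thesis
    proof (cases "s' = s")
      case True
      then show ?thesis
        unfolding valley_below.simps Let_def 2(1,2) using bounds by (cases zs) simp_all
    next
      case False
      then show ?thesis
        unfolding valley_below.simps Let_def 2(1,2) using bounds by (cases zs) simp_all
    qed
  qed simp
qed simp

section \<open>Cutting off a center by a half-plane\<close>

text \<open>
  The ray from \<open>c\<close> through a lattice point \<open>z\<close> is represented by its point on one of the vertical
  lines at horizontal distance \<open>1\<close> from \<open>c\<close>, or by a vertical neighbour of \<open>c\<close> if the ray is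
  vertical. Since the scale is at least \<open>1\<close>, this point lies between \<open>c\<close> and \<open>z\<close>, so a convex
  function that is smaller at \<open>z\<close> than at \<open>c\<close> is smaller there too.
\<close>

definition ray_scale :: "point \<Rightarrow> point \<Rightarrow> real" where
  "ray_scale c z = (if z $ 1 = c $ 1 then \<bar>z $ 2 - c $ 2\<bar> else \<bar>z $ 1 - c $ 1\<bar>)"

definition ray_point :: "point \<Rightarrow> point \<Rightarrow> point" where
  "ray_point c z = c + (1 / ray_scale c z) *\<^sub>R (z - c)"

definition vline :: "point \<Rightarrow> real \<Rightarrow> real \<Rightarrow> point" where
  "vline c \<sigma> y = c + vector [\<sigma>, y]"

definition slopes :: "point \<Rightarrow> real \<Rightarrow> point set \<Rightarrow> real set" where
  "slopes c \<sigma> P = (\<lambda>z. ray_point c z $ 2 - c $ 2) ` {z \<in> P. z \<noteq> c \<and> sgn (z $ 1 - c $ 1) = \<sigma>}"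

definition line_below ::
  "fun_id \<Rightarrow> point \<Rightarrow> real \<Rightarrow> nat \<Rightarrow> point set \<Rightarrow> real \<Rightarrow> real set eval_alg" where
  "line_below s c t l P \<sigma> =
     valley_below s (vline c \<sigma>) t l (sorted_list_of_set (slopes c \<sigma> P))"

definition separating_normal :: "point \<Rightarrow> point set \<Rightarrow> point" where
  "separating_normal c V = (SOME a. \<forall>v\<in>V. a \<bullet> v < a \<bullet> c)"

definition cut_at :: "fun_id \<Rightarrow> point \<Rightarrow> real \<Rightarrow> nat \<Rightarrow> point set \<Rightarrow> point set eval_alg" where
  "cut_at s c t l P =
     bind_alg (line_below s c t l P (-1)) (\<lambda>X.
     bind_alg (line_below s c t l P 0) (\<lambda>Y.
     bind_alg (line_below s c t l P 1) (\<lambda>Z.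
       let a = separating_normal c (vline c (-1) ` X \<union> vline c 0 ` Y \<union> vline c 1 ` Z)
       in Return {z \<in> P. a \<bullet> z < a \<bullet> c})))"

lemma lattice_neq_dist_ge_1:
  assumes "c \<in> lattice" "z \<in> lattice" "z $ i \<noteq> c $ i"
  shows "1 \<le> \<bar>z $ i - c $ i\<bar>"
proof -
  have "z $ i - c $ i \<in> \<int>" using assms(1,2) by (auto simp: lattice_def)
  then show ?thesis using assms(3) Ints_nonzero_abs_ge1 by force
qed

lemma ray_scale_ge_1:
  assumes "c \<in> lattice" "z \<in> lattice" "z \<noteq> c"
  shows "1 \<le> ray_scale c z"
proof (cases "z $ 1 = c $ 1")
  case True
  then have "z $ 2 \<noteq> c $ 2" using assms(3) by (auto simp: vec_eq_iff forall_2)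
  then show ?thesis using True lattice_neq_dist_ge_1[OF assms(1,2)] by (simp add: ray_scale_def)
qed (use lattice_neq_dist_ge_1[OF assms(1,2)] in \<open>simp add: ray_scale_def\<close>)

lemma vline_sgn_eq_ray_point:
  "vline c (sgn (z $ 1 - c $ 1)) (ray_point c z $ 2 - c $ 2) = ray_point c z"
proof -
  have "(1 / ray_scale c z) * (z $ 1 - c $ 1) = sgn (z $ 1 - c $ 1)"
    by (cases "z $ 1" "c $ 1" rule: linorder_cases) (simp_all add: ray_scale_def divide_eq_minus_1_iff)
  then show ?thesis
    by (simp add: vline_def ray_point_def vec_eq_iff forall_2)
qed

lemma convex_on_vline:
  assumes "convex_on UNIV f"
  shows "convex_on UNIV (\<lambda>y. f (vline c \<sigma> y))"
proof (rule convex_onI)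
  fix t x y :: real
  assume t: "0 < t" "t < 1"
  have "vline c \<sigma> ((1 - t) *\<^sub>R x + t *\<^sub>R y) = (1 - t) *\<^sub>R vline c \<sigma> x + t *\<^sub>R vline c \<sigma> y"
    by (simp add: vline_def vec_eq_iff forall_2 algebra_simps)
  then show "f (vline c \<sigma> ((1 - t) *\<^sub>R x + t *\<^sub>R y))
      \<le> (1 - t) * f (vline c \<sigma> x) + t * f (vline c \<sigma> y)"
    using convex_onD[OF assms, of t] t by simp
qed simp

text \<open>
  The values on \<open>V\<close> bound \<open>f\<close> on the whole convex hull of \<open>V\<close> below \<open>f c\<close>. Hence \<open>c\<close> is outside
  this hull and can be strictly separated from it.
\<close>

lemma separating_normal:
  assumes "convex_on UNIV f" "finite V" "\<And>v. v \<in> V \<Longrightarrow> f v < f c" "v \<in> V"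
  shows "separating_normal c V \<bullet> v < separating_normal c V \<bullet> c"
proof -
  have "c \<notin> convex hull V"
  proof
    assume "c \<in> convex hull V"
    moreover have "\<forall>x\<in>V. f x \<le> Max (f ` V)" using assms(2) by simp
    ultimately have "f c \<le> Max (f ` V)"
      using convex_on_convex_hull_bound[of V f] convex_on_subset[OF assms(1)] by auto
    moreover have "Max (f ` V) < f c"
      using assms(2-4) by (subst Max_less_iff) auto
    ultimately show False by simp
  qed
  then obtain a b where ab: "a \<bullet> c < b" "\<forall>x \<in> convex hull V. b < a \<bullet> x"
    using separating_hyperplane_closed_point[of "convex hull V" c] assms(2)
    by (auto simp: finite_imp_compact_convex_hull compact_imp_closed)
  have "\<forall>v\<in>V. (- a) \<bullet> v < (- a) \<bullet> c"
    using ab by (force intro: hull_inc)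
  then have "\<forall>v\<in>V. separating_normal c V \<bullet> v < separating_normal c V \<bullet> c"
    unfolding separating_normal_def by (rule someI)
  then show ?thesis using assms(4) by blast
qed

lemma outcome_line_below:
  assumes "finite P" "card P < 2 ^ l" "convex_on UNIV (F s)"
  shows "outcome F (line_below s c t l P \<sigma>) = {y \<in> slopes c \<sigma> P. F s (vline c \<sigma> y) < t}"
proof -
  have fin: "finite (slopes c \<sigma> P)" using assms(1) by (simp add: slopes_def)
  have "card (slopes c \<sigma> P) \<le> card P"
    unfolding slopes_def
    using assms(1) by (intro order.trans[OF card_image_le card_mono]) auto
  then show ?thesis
    unfolding line_below_def
    using outcome_valley_below[of "sorted_list_of_set (slopes c \<sigma> P)" l F s "vline c \<sigma>" t]
      convex_on_vline[OF assms(3)] assms(2) fin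
    by simp
qed

lemma num_evaluations_cut_at:
  "num_evaluations F (cut_at s c t l P) s' \<le> (if s' = s then 6 * l else 0)"
  using num_evaluations_valley_below[of F s "vline c (-1)" t l "sorted_list_of_set (slopes c (-1) P)" s']
    num_evaluations_valley_below[of F s "vline c 0" t l "sorted_list_of_set (slopes c 0 P)" s']
    num_evaluations_valley_below[of F s "vline c 1" t l "sorted_list_of_set (slopes c 1 P)" s']
  by (auto simp: cut_at_def line_below_def Let_def split: if_splits)

text \<open>
  A point \<open>z\<close> of \<open>P\<close> below the level of \<open>c\<close> has its ray point in the set \<open>V\<close> of points found by the three
  searches. The chosen half-plane contains \<open>V\<close> and has \<open>c\<close> on its boundary, so it contains the
  rest of the ray as well.
\<close>

lemma outcome_cut_at:
  assumes "lattice_convex P" "deep P c" "card P < 2 ^ l" "convex_on UNIV (F s)"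
  defines "Q \<equiv> outcome F (cut_at s c (F s c) l P)"
  shows "lattice_convex Q" "Q \<subseteq> P - {c}" "4 * card Q \<le> 3 * card P"
    "{z \<in> P. F s z < F s c} \<subseteq> Q"
proof -
  have finP: "finite P" and PL: "P \<subseteq> lattice" using assms(1) by (auto simp: lattice_convex_def)
  let ?A = "\<lambda>\<sigma>. {y \<in> slopes c \<sigma> P. F s (vline c \<sigma> y) < F s c}"
  define V where "V = vline c (-1) ` ?A (-1) \<union> vline c 0 ` ?A 0 \<union> vline c 1 ` ?A 1"
  define a where "a = separating_normal c V"
  have Q: "Q = {z \<in> P. a \<bullet> z < a \<bullet> c}"
    unfolding Q_def cut_at_def a_def V_def
    by (simp add: outcome_line_below[where F = F and s = s, OF finP assms(3,4)] Let_def)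
  have "Q = P \<inter> {z. a \<bullet> z < a \<bullet> c}" using Q by auto
  then show "lattice_convex Q"
    using lattice_convex_Int_convex[OF assms(1) convex_halfspace_lt] by simp
  show "Q \<subseteq> P - {c}" using Q by auto
  show "4 * card Q \<le> 3 * card P" using assms(2) Q by (auto simp: deep_def)
  have finV: "finite V" using finP by (simp add: V_def slopes_def)
  have V_lt: "F s v < F s c" if "v \<in> V" for v using that by (auto simp: V_def)
  show "{z \<in> P. F s z < F s c} \<subseteq> Q"
  proof clarify
    fix z assume z: "z \<in> P" "F s z < F s c"
    then have "z \<noteq> c" by auto
    define r where "r = ray_scale c z"
    have r: "1 \<le> r"
      using ray_scale_ge_1 assms(2) PL z(1) \<open>z \<noteq> c\<close> by (auto simp: r_def deep_def)
    have "ray_point c z = (1 - 1 / r) *\<^sub>R c + (1 / r) *\<^sub>R z"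
      by (simp add: ray_point_def r_def algebra_simps)
    then have "F s (ray_point c z) \<le> (1 - 1 / r) * F s c + (1 / r) * F s z"
      using convex_onD[OF assms(4), of "1 / r" c z] r by simp
    also have "\<dots> < F s c"
      using z(2) r by (simp add: field_simps)
    finally have less: "F s (ray_point c z) < F s c" .
    let ?\<sigma> = "sgn (z $ 1 - c $ 1)" and ?y = "ray_point c z $ 2 - c $ 2"
    have "?y \<in> ?A ?\<sigma>"
      using z(1) \<open>z \<noteq> c\<close> less by (auto simp: slopes_def vline_sgn_eq_ray_point)
    then have "ray_point c z \<in> vline c ?\<sigma> ` ?A ?\<sigma>"
      by (metis (no_types, lifting) image_eqI vline_sgn_eq_ray_point)
    moreover have "?\<sigma> = -1 \<or> ?\<sigma> = 0 \<or> ?\<sigma> = 1" by (simp add: sgn_if)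
    ultimately have "ray_point c z \<in> V" unfolding V_def by fastforce
    then have "a \<bullet> ray_point c z < a \<bullet> c"
      unfolding a_def using separating_normal[OF assms(4) finV V_lt] by simp
    then have "(1 / r) * (a \<bullet> (z - c)) < 0"
      by (simp add: ray_point_def r_def inner_add_right)
    then have "a \<bullet> (z - c) < 0"
      using r by (simp add: divide_less_0_iff)
    then show "z \<in> Q" using z(1) Q by (simp add: inner_diff_right)
  qed
qed


section \<open>Minimizing over one lattice-convex set\<close>

primrec first_violated :: "point \<Rightarrow> nat list \<Rightarrow> (nat \<times> real) option eval_alg" where
  "first_violated c [] = Return None"
| "first_violated c (i # js) =
     Eval (Constraint i) c (\<lambda>v. if 0 < v then Return (Some (i, v)) else first_violated c js)"

primrec better :: "(point \<times> real) option \<Rightarrow> point \<times> real \<Rightarrow> (point \<times> real) option" where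
  "better None y = Some y"
| "better (Some x) y = (if snd x \<le> snd y then Some x else Some y)"

text \<open>
  The accumulator \<open>b\<close> carries the best feasible point met so far with its value, so that
  no point is evaluated again when it is compared. The number \<open>T\<close> bounds the number of rounds.
\<close>

primrec cutting_planes ::
  "nat \<Rightarrow> nat \<Rightarrow> nat \<Rightarrow> point set \<Rightarrow> (point \<times> real) option \<Rightarrow> (point \<times> real) option eval_alg" where
  "cutting_planes m l 0 P b = Return b"
| "cutting_planes m l (Suc T) P b =
     (if P = {} then Return b else
      let c = (SOME c. deep P c) in
      bind_alg (first_violated c [Suc 0..<Suc m]) (\<lambda>r. case r of
          Some (i, v) \<Rightarrow> bind_alg (cut_at (Constraint i) c v l P) (\<lambda>Q. cutting_planes m l T Q b)
        | None \<Rightarrow> Eval Objective c (\<lambda>v.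
            bind_alg (cut_at Objective c v l P) (\<lambda>Q. cutting_planes m l T Q (better b (c, v))))))"

definition records_min :: "(point \<Rightarrow> real) \<Rightarrow> point set \<Rightarrow> (point \<times> real) option \<Rightarrow> bool" where
  "records_min f X b \<longleftrightarrow>
     (case b of None \<Rightarrow> X = {} | Some (x, v) \<Rightarrow> x \<in> X \<and> v = f x \<and> (\<forall>y\<in>X. f x \<le> f y))"

lemma records_min_better:
  assumes "records_min f X b" "c \<in> Y" "\<And>y. y \<in> Y \<Longrightarrow> f c \<le> f y"
  shows "records_min f (X \<union> Y) (better b (c, f c))"
  using assms by (cases b) (force simp: records_min_def)+

lemma outcome_first_violated:
  "case outcome (interp f g) (first_violated c js) of
     None \<Rightarrow> \<forall>i\<in>set js. g i c \<le> 0
   | Some (i, v) \<Rightarrow> i \<in> set js \<and> v = g i c \<and> 0 < v"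
  by (induction js) (auto split: option.splits)

lemma num_evaluations_first_violated:
  assumes "distinct js"
  shows "num_evaluations F (first_violated c js) s \<le> (if s \<in> Constraint ` set js then 1 else 0)"
  using assms
proof (induction js)
  case (Cons i js)
  then show ?case by (cases "s = Constraint i") (auto split: if_splits)
qed simp

definition fun_ids :: "nat \<Rightarrow> fun_id set" where
  "fun_ids m = insert Objective (Constraint ` {1..m})"

lemma set_constraint_indices: "set [Suc 0..<Suc m] = {1..m}"
  by (simp add: atLeastLessThanSuc_atLeastAtMost del: upt_Suc)

lemma num_evaluations_cutting_planes:
  "num_evaluations (interp f g) (cutting_planes m l T P b) s
     \<le> (if s \<in> fun_ids m then T * (1 + 6 * l) else 0)"
proof (induction T arbitrary: P b)
  case (Suc T)
  show ?case
  proof (cases "P = {}")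
    case False
    let ?F = "interp f g"
    define c where "c = (SOME c. deep P c)"
    define r where "r = outcome ?F (first_violated c [Suc 0..<Suc m])"
    have first: "num_evaluations ?F (first_violated c [Suc 0..<Suc m]) s
        \<le> (if s \<in> Constraint ` {1..m} then 1 else 0)"
      using num_evaluations_first_violated[of "[Suc 0..<Suc m]" ?F c s]
      unfolding set_constraint_indices by simp
    note spec = outcome_first_violated[where f = f and g = g and c = c and js = "[Suc 0..<Suc m]", folded r_def,
      unfolded set_constraint_indices]
    show ?thesis
    proof (cases r)
      case None
      define Q where "Q = outcome ?F (cut_at Objective c (f c) l P)"
      have "num_evaluations ?F (cutting_planes m l (Suc T) P b) s =
          num_evaluations ?F (first_violated c [Suc 0..<Suc m]) s + (if Objective = s then 1 else 0) +
          num_evaluations ?F (cut_at Objective c (f c) l P) s +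
          num_evaluations ?F (cutting_planes m l T Q (better b (c, f c))) s"
        using False None
        by (simp add: Let_def c_def[symmetric] r_def[symmetric] Q_def[symmetric] del: upt_Suc)
      also have "\<dots> \<le> (if s \<in> fun_ids m then 1 else 0) + (if s \<in> fun_ids m then 6 * l else 0) +
          (if s \<in> fun_ids m then T * (1 + 6 * l) else 0)"
      proof (intro add_mono Suc)
        show "num_evaluations ?F (first_violated c [Suc 0..<Suc m]) s + (if Objective = s then 1 else 0)
            \<le> (if s \<in> fun_ids m then 1 else 0)"
          using first by (cases s) (auto simp: fun_ids_def simp del: upt_Suc split: if_splits)
        show "num_evaluations ?F (cut_at Objective c (f c) l P) s \<le> (if s \<in> fun_ids m then 6 * l else 0)"
          by (rule order.trans[OF num_evaluations_cut_at]) (simp add: fun_ids_def)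
      qed
      also have "\<dots> = (if s \<in> fun_ids m then Suc T * (1 + 6 * l) else 0)" by simp
      finally show ?thesis .
    next
      case (Some iv)
      obtain i v where iv: "iv = (i, v)" by (cases iv)
      have i: "i \<in> {1..m}" using spec Some iv by simp
      define Q where "Q = outcome ?F (cut_at (Constraint i) c v l P)"
      have "num_evaluations ?F (cutting_planes m l (Suc T) P b) s =
          num_evaluations ?F (first_violated c [Suc 0..<Suc m]) s +
          num_evaluations ?F (cut_at (Constraint i) c v l P) s +
          num_evaluations ?F (cutting_planes m l T Q b) s"
        using False Some iv
        by (simp add: Let_def c_def[symmetric] r_def[symmetric] Q_def[symmetric] del: upt_Suc)
      also have "\<dots> \<le> (if s \<in> fun_ids m then 1 else 0) + (if s \<in> fun_ids m then 6 * l else 0) +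
          (if s \<in> fun_ids m then T * (1 + 6 * l) else 0)"
      proof (intro add_mono Suc)
        show "num_evaluations ?F (first_violated c [Suc 0..<Suc m]) s \<le> (if s \<in> fun_ids m then 1 else 0)"
          by (rule order.trans[OF first]) (simp add: fun_ids_def)
        have "Constraint i \<in> fun_ids m" using i by (simp add: fun_ids_def)
        then show "num_evaluations ?F (cut_at (Constraint i) c v l P) s
            \<le> (if s \<in> fun_ids m then 6 * l else 0)"
          using num_evaluations_cut_at[of ?F "Constraint i" c v l P s] by (auto split: if_splits)
      qed
      also have "\<dots> = (if s \<in> fun_ids m then Suc T * (1 + 6 * l) else 0)" by simp
      finally show ?thesis .
    qed
  qed simp
qed simp

text \<open>
  Each round multiplies the size of \<open>P\<close> by at most \<open>3 / 4\<close>, so the hypothesis relating \<open>card P\<close> and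
  \<open>T\<close> passes to the next round, and after the last one it forces \<open>P\<close> to be empty. The points lost in
  a round are infeasible or not better than a feasible center, which is compared with the record;
  so the record stays optimal when the feasible ones among them are added to \<open>X\<close>.
\<close>

lemma outcome_cutting_planes:
  assumes "convex_on UNIV f" "\<And>i. i \<in> {1..m} \<Longrightarrow> convex_on UNIV (g i)"
    and "lattice_convex P" "card P < 2 ^ l" "card P * 3 ^ T < 4 ^ T"
    and "records_min f X b"
  shows "records_min f (X \<union> (feasible_region m g \<inter> P))
           (outcome (interp f g) (cutting_planes m l T P b))"
  using assms(3-)
proof (induction T arbitrary: P b X)
  case 0
  then have "P = {}" by (simp add: lattice_convex_def)
  then show ?case using 0 by simp
next
  case (Suc T)
  let ?F = "interp f g" and ?S = "feasible_region m g"
  show ?case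
  proof (cases "P = {}")
    case False
    define c where "c = (SOME c. deep P c)"
    have deep: "deep P c"
      unfolding c_def using deep_point_exists[OF Suc.prems(1) False] by (rule someI_ex)
    define r where "r = outcome ?F (first_violated c [Suc 0..<Suc m])"
    note spec = outcome_first_violated[where f = f and g = g and c = c and js = "[Suc 0..<Suc m]", folded r_def,
      unfolded set_constraint_indices]
    have shrink: "card Q < 2 ^ l \<and> card Q * 3 ^ T < 4 ^ T" if "4 * card Q \<le> 3 * card P" for Q :: "point set"
    proof
      show "card Q < 2 ^ l" using that Suc.prems(2) by linarith
      have "4 * (card Q * 3 ^ T) = (4 * card Q) * 3 ^ T" by simp
      also have "\<dots> \<le> (3 * card P) * 3 ^ T" using that by (rule mult_le_mono1)
      also have "\<dots> = card P * 3 ^ Suc T" by simp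
      also have "\<dots> < 4 ^ Suc T" by (rule Suc.prems(3))
      finally have "4 * (card Q * 3 ^ T) < 4 * 4 ^ T" by (simp only: power_Suc)
      then show "card Q * 3 ^ T < 4 ^ T" by simp
    qed
    show ?thesis
    proof (cases r)
      case None
      define Q where "Q = outcome ?F (cut_at Objective c (f c) l P)"
      note Q = outcome_cut_at[where F = ?F and s = Objective, OF Suc.prems(1) deep Suc.prems(2),
        simplified, OF assms(1), folded Q_def]
      have "c \<in> ?S \<inter> (P - Q)"
        using spec None deep Q(2) by (auto simp: feasible_region_def deep_def)
      moreover have "f c \<le> f y" if "y \<in> ?S \<inter> (P - Q)" for y
        using Q(4) that by (auto simp: subset_iff not_less)
      ultimately have "records_min f (X \<union> (?S \<inter> (P - Q))) (better b (c, f c))"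
        by (rule records_min_better[OF Suc.prems(4)])
      then have "records_min f (X \<union> (?S \<inter> (P - Q)) \<union> (?S \<inter> Q))
          (outcome ?F (cutting_planes m l T Q (better b (c, f c))))"
        using shrink[OF Q(3)] by (intro Suc.IH Q(1)) auto
      moreover have "X \<union> (?S \<inter> (P - Q)) \<union> (?S \<inter> Q) = X \<union> (?S \<inter> P)"
        using Q(2) by auto
      moreover have "outcome ?F (cutting_planes m l (Suc T) P b) =
          outcome ?F (cutting_planes m l T Q (better b (c, f c)))"
        using False None
        by (simp add: Let_def c_def[symmetric] r_def[symmetric] Q_def[symmetric] del: upt_Suc)
      ultimately show ?thesis by simp
    next
      case (Some iv)
      then obtain i where iv: "iv = (i, g i c)" "i \<in> {1..m}" "0 < g i c"
        using spec by (cases iv) auto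
      define Q where "Q = outcome ?F (cut_at (Constraint i) c (g i c) l P)"
      note Q = outcome_cut_at[where F = ?F and s = "Constraint i",
        OF Suc.prems(1) deep Suc.prems(2), simplified, OF assms(2)[OF iv(2)], folded Q_def]
      have "g i z < g i c" if "z \<in> ?S" for z
        using that iv(2,3) by (force simp: feasible_region_def)
      then have "?S \<inter> P = ?S \<inter> Q" using Q(2,4) by blast
      moreover have "records_min f (X \<union> (?S \<inter> Q)) (outcome ?F (cutting_planes m l T Q b))"
        using shrink[OF Q(3)] by (intro Suc.IH Q(1) Suc.prems(4)) auto
      moreover have "outcome ?F (cutting_planes m l (Suc T) P b) =
          outcome ?F (cutting_planes m l T Q b)"
        using False Some iv(1)
        by (simp add: Let_def c_def[symmetric] r_def[symmetric] Q_def[symmetric] del: upt_Suc)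
      ultimately show ?thesis by simp
    qed
  next
    case True
    then show ?thesis using Suc.prems(4) by simp
  qed
qed

section \<open>Lexicographic gaps between the excluded points\<close>

text \<open>
  The lexicographic order is a linear order whose positive elements form a convex cone. Its
  intervals are therefore convex sets, and \<open>n\<close> points leave only \<open>n + 1\<close> gaps between them. A gap is
  addressed by the number of points of \<open>X\<close> before it.
\<close>

definition lex_less :: "point \<Rightarrow> point \<Rightarrow> bool" where
  "lex_less x y \<longleftrightarrow> x $ 1 < y $ 1 \<or> x $ 1 = y $ 1 \<and> x $ 2 < y $ 2"

definition lex_gap :: "point set \<Rightarrow> nat \<Rightarrow> point set" where
  "lex_gap X j = {z. z \<notin> X \<and> card {x \<in> X. lex_less x z} = j}"

lemma lex_less_irrefl: "\<not> lex_less x x"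
  by (simp add: lex_less_def)

lemma lex_less_trans: "lex_less x y \<Longrightarrow> lex_less y z \<Longrightarrow> lex_less x z"
  by (auto simp: lex_less_def)

lemma lex_less_linear: "lex_less x y \<or> x = y \<or> lex_less y x"
  by (auto simp: lex_less_def vec_eq_iff forall_2)

lemma lex_less_diff: "lex_less x y \<longleftrightarrow> lex_less 0 (y - x)"
  by (auto simp: lex_less_def)

lemma lex_positive_cone:
  "lex_less 0 x \<Longrightarrow> 0 < (t :: real) \<Longrightarrow> lex_less 0 (t *\<^sub>R x)"
  "lex_less 0 x \<Longrightarrow> lex_less 0 y \<Longrightarrow> lex_less 0 (x + y)"
  by (auto simp: lex_less_def)

lemma lex_less_convex_combination:
  assumes "0 < t" "t < 1"
  shows "lex_less a x \<Longrightarrow> lex_less a y \<Longrightarrow> lex_less a ((1 - t) *\<^sub>R x + t *\<^sub>R y)"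
    and "lex_less x a \<Longrightarrow> lex_less y a \<Longrightarrow> lex_less ((1 - t) *\<^sub>R x + t *\<^sub>R y) a"
proof -
  have "(1 - t) *\<^sub>R x + t *\<^sub>R y - a = (1 - t) *\<^sub>R (x - a) + t *\<^sub>R (y - a)"
    "a - ((1 - t) *\<^sub>R x + t *\<^sub>R y) = (1 - t) *\<^sub>R (a - x) + t *\<^sub>R (a - y)"
    by (simp_all add: algebra_simps)
  then show "lex_less a x \<Longrightarrow> lex_less a y \<Longrightarrow> lex_less a ((1 - t) *\<^sub>R x + t *\<^sub>R y)"
    "lex_less x a \<Longrightarrow> lex_less y a \<Longrightarrow> lex_less ((1 - t) *\<^sub>R x + t *\<^sub>R y) a"
    using assms lex_positive_cone lex_less_diff by (metis diff_gt_0_iff_gt)+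
qed

text \<open>
  The sets of points of \<open>X\<close> below \<open>x\<close> and below \<open>y\<close> are nested and of equal size, hence equal. So each
  point of \<open>X\<close> lies below both of \<open>x\<close> and \<open>y\<close> or above both, and it is on the same side of the points
  between them.
\<close>

lemma convex_lex_gap:
  assumes "finite X"
  shows "convex (lex_gap X j)"
proof (clarsimp simp: convex_alt)
  fix x y and t :: real
  assume x: "x \<in> lex_gap X j" and y: "y \<in> lex_gap X j" and t: "0 \<le> t" "t \<le> 1"
  let ?w = "(1 - t) *\<^sub>R x + t *\<^sub>R y"
  let ?below = "\<lambda>z. {x \<in> X. lex_less x z}"
  have "?below x \<subseteq> ?below y \<or> ?below y \<subseteq> ?below x"
    using lex_less_linear[of x y] lex_less_trans by blast
  moreover have "card (?below x) = card (?below y)"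
    using x y by (simp add: lex_gap_def)
  ultimately have same: "?below x = ?below y"
    using assms card_subset_eq[of "?below x" "?below y"] card_subset_eq[of "?below y" "?below x"]
    by auto
  show "?w \<in> lex_gap X j"
  proof (cases "t = 0 \<or> t = 1")
    case True
    then show ?thesis using x y by auto
  next
    case False
    then have t': "0 < t" "t < 1" using t by auto
    have side: "(lex_less a x \<and> lex_less a ?w) \<or> (\<not> lex_less a x \<and> lex_less ?w a)" if "a \<in> X" for a
    proof (cases "lex_less a x")
      case True
      then have "lex_less a y" using same that by blast
      then show ?thesis using True lex_less_convex_combination(1)[OF t'] by blast
    next
      case False
      then have "\<not> lex_less a y" using same that by blast
      moreover have "a \<noteq> x" "a \<noteq> y" using x y that by (auto simp: lex_gap_def)
      ultimately show ?thesis
        using False lex_less_linear lex_less_convex_combination(2)[OF t'] by blast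
    qed
    then have "?w \<notin> X" using lex_less_irrefl by blast
    moreover have "?below ?w = ?below x"
      using side lex_less_irrefl lex_less_trans by blast
    ultimately show ?thesis using x by (simp add: lex_gap_def)
  qed
qed

lemma UN_lex_gap:
  assumes "finite X" "card X < k"
  shows "(\<Union>j<k. lex_gap X j) = - X"
proof -
  have "card {x \<in> X. lex_less x z} < k" for z
    using card_mono[OF assms(1), of "{x \<in> X. lex_less x z}"] assms(2) by (auto intro: le_less_trans)
  then show ?thesis by (auto simp: lex_gap_def)
qed

section \<open>The algorithm and its cost\<close>

primrec minimize_over ::
  "nat \<Rightarrow> nat \<Rightarrow> nat \<Rightarrow> point set list \<Rightarrow> (point \<times> real) option \<Rightarrow> (point \<times> real) option eval_alg" where
  "minimize_over m l T [] b = Return b"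
| "minimize_over m l T (P # Ps) b = bind_alg (cutting_planes m l T P b) (minimize_over m l T Ps)"

lemma num_evaluations_minimize_over:
  "num_evaluations (interp f g) (minimize_over m l T Ps b) s
     \<le> (if s \<in> fun_ids m then length Ps * (T * (1 + 6 * l)) else 0)"
proof (induction Ps arbitrary: b)
  case (Cons P Ps)
  show ?case
    using add_mono[OF num_evaluations_cutting_planes[of f g m l T P b s]
      Cons[of "outcome (interp f g) (cutting_planes m l T P b)"]]
    by (auto split: if_splits)
qed simp

lemma outcome_minimize_over:
  assumes "convex_on UNIV f" "\<And>i. i \<in> {1..m} \<Longrightarrow> convex_on UNIV (g i)"
    and "\<And>P. P \<in> set Ps \<Longrightarrow> lattice_convex P \<and> card P < 2 ^ l \<and> card P * 3 ^ T < 4 ^ T"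
    and "records_min f X b"
  shows "records_min f (X \<union> (feasible_region m g \<inter> \<Union>(set Ps)))
           (outcome (interp f g) (minimize_over m l T Ps b))"
  using assms(3-)
proof (induction Ps arbitrary: X b)
  case Nil
  show ?case using Nil.prems(2) by simp
next
  case (Cons P Ps)
  have "records_min f (X \<union> (feasible_region m g \<inter> P))
      (outcome (interp f g) (cutting_planes m l T P b))"
    using Cons.prems by (intro outcome_cutting_planes assms(1,2)) auto
  then have "records_min f (X \<union> (feasible_region m g \<inter> P) \<union> (feasible_region m g \<inter> \<Union>(set Ps)))
      (outcome (interp f g) (minimize_over m l T (P # Ps) b))"
    unfolding minimize_over.simps outcome_bind_alg
    by (rule Cons.IH[rotated]) (rule Cons.prems(1), simp)
  then show ?case
    by (simp only: list.set Union_insert Int_Un_distrib Un_assoc)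
qed

definition next_best_alg :: "nat \<Rightarrow> nat \<Rightarrow> nat \<Rightarrow> nat \<Rightarrow> point list \<Rightarrow> point option eval_alg" where
  "next_best_alg l m B k xs =
     bind_alg (minimize_over m l (3 * l) (map (\<lambda>j. integer_box B \<inter> lex_gap (set xs) j) [0..<k]) None)
       (\<lambda>b. Return (map_option fst b))"

lemma num_evaluations_next_best_alg:
  "num_evaluations (interp f g) (next_best_alg l m B k xs) s
     \<le> (if s \<in> fun_ids m then k * (3 * l * (1 + 6 * l)) else 0)"
  using num_evaluations_minimize_over[of f g m l "3 * l"
      "map (\<lambda>j. integer_box B \<inter> lex_gap (set xs) j) [0..<k]" None s]
  unfolding next_best_alg_def num_evaluations_bind_alg num_evaluations_Return length_map
    length_upt diff_zero add_0_right .

lemma integer_box_card: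
  "finite (integer_box B)" "card (integer_box B) \<le> (2 * B + 1)\<^sup>2"
proof -
  let ?I = "{- int B..int B}" and ?fl = "\<lambda>z :: point. (\<lfloor>z $ 1\<rfloor>, \<lfloor>z $ 2\<rfloor>)"
  have inj: "inj_on ?fl (integer_box B)"
  proof (rule inj_onI)
    fix x y assume xy: "x \<in> integer_box B" "y \<in> integer_box B" "?fl x = ?fl y"
    have "z $ i = of_int \<lfloor>z $ i\<rfloor>" if "z \<in> integer_box B" for z i
      using that by (simp add: integer_box_def)
    then have "x $ i = y $ i" for i
      using xy exhaust_2[of i] by (metis prod.inject)
    then show "x = y" by (simp add: vec_eq_iff)
  qed
  have "- int B \<le> \<lfloor>z $ i\<rfloor> \<and> \<lfloor>z $ i\<rfloor> \<le> int B" if "z \<in> integer_box B" for z i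
  proof -
    have "- real B \<le> z $ i" "z $ i \<le> real B" using that by (auto simp: integer_box_def)
    then show ?thesis by linarith
  qed
  then have sub: "?fl ` integer_box B \<subseteq> ?I \<times> ?I" by auto
  show "finite (integer_box B)"
    using inj_on_finite[OF inj sub] by simp
  have "card (integer_box B) \<le> card (?I \<times> ?I)"
    using card_inj_on_le[OF inj sub] by simp
  also have "card (?I \<times> ?I) = (2 * B + 1)\<^sup>2"
    by (simp add: card_cartesian_product power2_eq_square nat_add_distrib nat_mult_distrib)
  finally show "card (integer_box B) \<le> (2 * B + 1)\<^sup>2" .
qed

lemma lattice_convex_integer_box: "lattice_convex (integer_box B)"
proof -
  have box: "integer_box B = lattice \<inter> cbox (\<chi> i. - real B) (\<chi> i. real B)"
    by (auto simp: integer_box_def lattice_def mem_box_cart)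
  then have "convex hull integer_box B \<subseteq> cbox (\<chi> i. - real B) (\<chi> i. real B)"
    by (intro hull_minimal) (auto simp: convex_box)
  then show ?thesis
    using box integer_box_card(1)[of B] unfolding lattice_convex_def by (intro conjI) blast+
qed

lemma outcome_next_best_alg:
  assumes "convex_on UNIV f" "\<And>i. i \<in> {1..m} \<Longrightarrow> convex_on UNIV (g i)"
    and "length xs < k" "(2 * B + 1)\<^sup>2 < 2 ^ l"
  defines "D \<equiv> feasible_region m g \<inter> integer_box B"
  shows "case outcome (interp f g) (next_best_alg l m B k xs) of
      Some x \<Rightarrow> next_best f D xs x
    | None \<Rightarrow> \<not> (\<exists>x. next_best f D xs x)"
proof -
  let ?Ps = "map (\<lambda>j. integer_box B \<inter> lex_gap (set xs) j) [0..<k]"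
  define b where "b = outcome (interp f g) (minimize_over m l (3 * l) ?Ps None)"
  have piece: "lattice_convex P \<and> card P < 2 ^ l \<and> card P * 3 ^ (3 * l) < 4 ^ (3 * l)"
    if P_in: "P \<in> set ?Ps" for P
  proof -
    obtain j where P: "P = integer_box B \<inter> lex_gap (set xs) j"
      using P_in unfolding set_map by blast
    have "card P \<le> card (integer_box B)"
      unfolding P using integer_box_card(1) by (intro card_mono) auto
    then have card: "card P < 2 ^ l" using integer_box_card(2)[of B] assms(4) by linarith
    (* Three rounds at least halve the piece, since 2 * 3 ^ 3 < 4 ^ 3. *)
    have "card P * 3 ^ (3 * l) < 2 ^ l * 3 ^ (3 * l)" using card by simp
    also have "\<dots> = 54 ^ l" by (simp add: power_mult power_mult_distrib[symmetric])
    also have "\<dots> \<le> (64 :: nat) ^ l" by (rule power_mono) auto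
    also have "\<dots> = 4 ^ (3 * l)" by (simp add: power_mult)
    finally have "card P * 3 ^ (3 * l) < 4 ^ (3 * l)" .
    then show ?thesis
      using card P lattice_convex_Int_convex[OF lattice_convex_integer_box convex_lex_gap] by simp
  qed
  have "records_min f ({} \<union> (feasible_region m g \<inter> \<Union>(set ?Ps))) b"
    unfolding b_def
    using piece by (intro outcome_minimize_over assms(1,2)) (auto simp: records_min_def)
  moreover have "card (set xs) < k" using card_length[of xs] assms(3) by linarith
  then have "\<Union>(set ?Ps) = integer_box B - set xs"
    using UN_lex_gap[of "set xs" k] by (auto simp: atLeast0LessThan)
  ultimately have "records_min f (D - set xs) b"
    by (simp add: D_def Int_Diff)
  then show ?thesis
    by (auto simp: next_best_alg_def b_def[symmetric] records_min_def next_best_def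
        is_arg_min_linorder split: option.splits)
qed

text \<open>
  For \<open>B = 0\<close> the convention \<open>ln 0 = 0\<close> makes the logarithm vanish, and the additive constants take
  care of the box with a single point.
\<close>

definition num_bits :: "nat \<Rightarrow> nat" where
  "num_bits B = 2 * (nat \<lfloor>log 2 (real B)\<rfloor> + 1) + 2"

lemma box_card_less_num_bits: "(2 * B + 1)\<^sup>2 < 2 ^ num_bits B"
proof -
  let ?b = "nat \<lfloor>log 2 (real B)\<rfloor> + 1"
  have "B < 2 ^ ?b"
  proof (cases "B = 0")
    case False
    then have "log 2 (real B) < real ?b" by linarith
    then have "real B < 2 powr real ?b" using False by (simp add: log_less_iff)
    then show ?thesis
      by (metis of_nat_less_iff of_nat_numeral of_nat_power powr_realpow zero_less_numeral)
  qed simp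
  then have "2 * B + 1 < 2 ^ (?b + 1)" by simp
  then have "(2 * B + 1)\<^sup>2 < (2 ^ (?b + 1))\<^sup>2"
    by (intro power_strict_mono) auto
  also have "\<dots> = 2 ^ num_bits B"
    by (simp add: num_bits_def power_mult[symmetric] ac_simps)
  finally show ?thesis .
qed

lemma num_bits_le: "real (num_bits B) \<le> 4 + 2 / ln 2 * ln (real B)"
proof -
  have "0 \<le> log 2 (real B)" by (cases "B = 0") (auto simp: log_def)
  then have "real (nat \<lfloor>log 2 (real B)\<rfloor>) \<le> log 2 (real B)" by simp
  then show ?thesis by (simp add: num_bits_def log_def)
qed

theorem corollary2:
  "\<exists>(p :: real poly poly)
     (alg :: nat \<Rightarrow> nat \<Rightarrow> nat \<Rightarrow> point list \<Rightarrow> point option eval_alg).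
   \<forall>(m :: nat) (B :: nat) (k :: nat) (f :: point \<Rightarrow> real) (g :: nat \<Rightarrow> point \<Rightarrow> real)
     (xs :: point list).
     convex_on UNIV f \<longrightarrow>
     (\<forall>i\<in>{1..m}. convex_on UNIV (g i)) \<longrightarrow>
     2 \<le> k \<longrightarrow>
     length xs = k - 1 \<longrightarrow>
     best_points f (feasible_region m g \<inter> integer_box B) xs \<longrightarrow>
       (case outcome (interp f g) (alg m B k xs) of
          Some x \<Rightarrow> next_best f (feasible_region m g \<inter> integer_box B) xs x
        | None \<Rightarrow> \<not> (\<exists>x. next_best f (feasible_region m g \<inter> integer_box B) xs x)) \<and>
       fst ` set (evaluations (interp f g) (alg m B k xs)) \<subseteq> insert Objective (Constraint ` {1..m}) \<and>
       (\<forall>s \<in> insert Objective (Constraint ` {1..m}).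
          real (num_evaluations (interp f g) (alg m B k xs) s) \<le> poly2 p (ln (real B)) (real k))"
proof -
  define L :: "real poly" where "L = [:4, 2 / ln 2:]"
  define p :: "real poly poly" where "p = [:0, 3 * L * (1 + 6 * L):]"
  have poly2_p: "poly2 p x y = y * (3 * (4 + 2 / ln 2 * x) * (1 + 6 * (4 + 2 / ln 2 * x)))" for x y
    by (simp add: poly2_def p_def L_def mult.commute)
  define alg where "alg = (\<lambda>m B. next_best_alg (num_bits B) m B)"
  show ?thesis
  proof (rule exI[of _ p], rule exI[of _ alg], intro allI impI conjI)
    fix m B k :: nat and f :: "point \<Rightarrow> real" and g :: "nat \<Rightarrow> point \<Rightarrow> real" and xs :: "point list"
    assume f: "convex_on UNIV f" and g: "\<forall>i\<in>{1..m}. convex_on UNIV (g i)"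
      and k: "2 \<le> k" "length xs = k - 1"
    show "case outcome (interp f g) (alg m B k xs) of
        Some x \<Rightarrow> next_best f (feasible_region m g \<inter> integer_box B) xs x
      | None \<Rightarrow> \<not> (\<exists>x. next_best f (feasible_region m g \<inter> integer_box B) xs x)"
      unfolding alg_def
      using f g k box_card_less_num_bits by (intro outcome_next_best_alg) auto
    have count: "num_evaluations (interp f g) (alg m B k xs) s
        \<le> (if s \<in> fun_ids m then k * (3 * num_bits B * (1 + 6 * num_bits B)) else 0)" for s
      unfolding alg_def by (rule num_evaluations_next_best_alg)
    show "fst ` set (evaluations (interp f g) (alg m B k xs)) \<subseteq> insert Objective (Constraint ` {1..m})"
    proof
      fix s assume "s \<in> fst ` set (evaluations (interp f g) (alg m B k xs))"
      then have "num_evaluations (interp f g) (alg m B k xs) s \<noteq> 0"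
        by (simp add: num_evaluations_def count_list_0_iff)
      then show "s \<in> insert Objective (Constraint ` {1..m})"
        using count[of s] by (auto simp: fun_ids_def split: if_splits)
    qed
    show "\<forall>s \<in> insert Objective (Constraint ` {1..m}).
        real (num_evaluations (interp f g) (alg m B k xs) s) \<le> poly2 p (ln (real B)) (real k)"
    proof
      fix s assume "s \<in> insert Objective (Constraint ` {1..m})"
      then have "num_evaluations (interp f g) (alg m B k xs) s
          \<le> k * (3 * num_bits B * (1 + 6 * num_bits B))"
        using count[of s] by (simp add: fun_ids_def)
      then have "real (num_evaluations (interp f g) (alg m B k xs) s)
          \<le> real (k * (3 * num_bits B * (1 + 6 * num_bits B)))"
        by (simp only: of_nat_le_iff)
      also have "\<dots> = real k * (3 * real (num_bits B) * (1 + 6 * real (num_bits B)))"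
        by (simp add: algebra_simps)
      also have "\<dots> \<le> poly2 p (ln (real B)) (real k)"
        unfolding poly2_p using num_bits_le[of B]
        by (intro mult_left_mono mult_mono add_mono) auto
      finally show "real (num_evaluations (interp f g) (alg m B k xs) s)
          \<le> poly2 p (ln (real B)) (real k)" .
    qed
  qed
qed

end
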